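(* Let $\mathbb{E}: K\xrightarrow{k}X\xrightarrow{f}M$ be a Schreier extension of monoids with $K$ commutative and cancellative, and let $K\xrightarrow{\overline{\kappa}}df\xrightarrow{\overline{f}}M$, with section $\overline{s}\colon M\to df$ and Schreier retraction $\overline{q}\colon df\to K$, be the associated Schreier point (see context). Then the monoid action of $M$ on $K$ induced by this Schreier point, $m\bullet a=\overline{q}(\overline{s}(m)+\overline{\kappa}(a))$, coincides with the monoid action $m\ast a$ induced by $\mathbb{E}$.
   Context: Monoids $K,X,df$ are written additively ($X$ is not assumed commutative) and $M$ multiplicatively with unit $1$. A monoid extension $\mathbb{E}:K\xrightarrow{k}X\xrightarrow{f}M$ consists of a surjective monoid homomorphism $f$ and a kernel $(K,k)$ of $f$. For $m\in M$, the set of representatives of $m$ is $B_m=\{u\in f^{-1}(m): \forall x\in f^{-1}(m)\ \exists!\,a\in K,\ x=k(a)+u\}$. $\mathbb{E}$ is a Schreier extension if $B_m\neq\emptyset$ for all $m\in M$. If $K$ is commutative and cancellative, the action of $M$ on $K$ induced by $\mathbb{E}$ sends $(m,a)$ to the unique element $m\ast a\in K$ with $u+k(a)=k(m\ast a)+u$ for $u\in B_m$ (independent of the choice of $u$). Construction of $df$: let $R_{\mathbb{E}}=\{(x,k(a)+x): x\in X,a\in K\}$, a submonoid of $X\times X$ (in each pair the element $a$ is uniquely determined), and let $P_{\mathbb{E}}=\{(x,k(a)+x,k(b)+k(a)+x): x\in X,\ a,b\in K\}$, a submonoid of $X^3$. Let $\pi_1,p_2\colon P_{\mathbb{E}}\to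 R_{\mathbb{E}}$ be the homomorphisms $\pi_1(x,k(a)+x,k(b)+k(a)+x)=(x,k(b)+x)$ and $p_2(x,k(a)+x,k(b)+k(a)+x)=(k(a)+x,k(b)+k(a)+x)$. Let $\gamma\colon R_{\mathbb{E}}\to df$ be a coequaliser of $(\pi_1,p_2)$ in the category of monoids. Define $\overline{f}(\gamma(x,k(a)+x))=f(x)$, $\overline{s}(m)=\gamma(x,x)$ for any $x$ with $f(x)=m$, and $\overline{\kappa}(a)=\gamma(0,k(a))$; these are well-defined homomorphisms, and the Schreier retraction is the well-defined map of sets $\overline{q}(\gamma(x,k(a)+x))=a$. A Schreier point is a split extension of monoids $K\xrightarrow{k}B\xrightarrow{f}M$ with a fixed homomorphic section $s$ of $f$, $(K,k)$ a kernel of $f$, for which there is a unique map of sets $q\colon B\to K$ (the Schreier retraction) with $b=kq(b)+sf(b)$ for all $b\in B$. *)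

theory Defs
  imports "HOL-Algebra.Coset" "HOL-Algebra.Divisibility"
begin

text \<open>
  All monoids, also those usually written additively, are monoid records of HOL-Algebra and use
  \<open>\<otimes>\<close> and \<open>\<one>\<close>.
\<close>

section \<open>Monoid homomorphisms, kernels and coequalisers\<close>

text \<open>For monoids, membership in \<^const>\<open>hom\<close> does not imply preservation of the unit.\<close>

definition mon_hom :: "('a, 'm) monoid_scheme \<Rightarrow> ('b, 'n) monoid_scheme \<Rightarrow> ('a \<Rightarrow> 'b) set" where
  "mon_hom G H = {h \<in> hom G H. h \<one>\<^bsub>G\<^esub> = \<one>\<^bsub>H\<^esub>}"

definition is_kernel ::
  "('k, 'p) monoid_scheme \<Rightarrow> ('x, 'q) monoid_scheme \<Rightarrow> ('m, 'r) monoid_scheme \<Rightarrow>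
    ('k \<Rightarrow> 'x) \<Rightarrow> ('x \<Rightarrow> 'm) \<Rightarrow> bool" where
  "is_kernel K X M k f \<longleftrightarrow> k \<in> iso K (X\<lparr>carrier := kernel X M f\<rparr>)"

definition coequalises ::
  "('a, 'm) monoid_scheme \<Rightarrow> ('b, 'n) monoid_scheme \<Rightarrow> ('a \<Rightarrow> 'b) \<Rightarrow> ('a \<Rightarrow> 'b) \<Rightarrow>
    ('z, 'l) monoid_scheme \<Rightarrow> ('b \<Rightarrow> 'z) \<Rightarrow> bool" where
  "coequalises A B g h Z t \<longleftrightarrow>
     monoid Z \<and> t \<in> mon_hom B Z \<and> (\<forall>x\<in>carrier A. t (g x) = t (h x))"

text \<open>The universal property, tested against the monoids on the type \<open>'z\<close>.\<close>

definition coequaliser_for ::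
  "'z itself \<Rightarrow> ('a, 'm) monoid_scheme \<Rightarrow> ('b, 'n) monoid_scheme \<Rightarrow> ('a \<Rightarrow> 'b) \<Rightarrow> ('a \<Rightarrow> 'b) \<Rightarrow>
    ('d, 'l) monoid_scheme \<Rightarrow> ('b \<Rightarrow> 'd) \<Rightarrow> bool" where
  "coequaliser_for (_ :: 'z itself) A B g h D c \<longleftrightarrow>
     coequalises A B g h D c \<and>
     (\<forall>(Z :: 'z monoid) t. coequalises A B g h Z t \<longrightarrow>
        (\<exists>!e. e \<in> mon_hom D Z \<inter> extensional (carrier D) \<and> (\<forall>x\<in>carrier B. e (c x) = t x)))"

text \<open>
  A definition in HOL cannot quantify over all types \<open>'z\<close>. It suffices to test against the monoids
  on the type of \<open>D\<close> itself and on the sets of elements of \<open>B\<close> (where the quotients of \<open>B\<close> live):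
  lemma \<open>coequaliser_universal\<close> below derives the universal property for every type.
\<close>

definition coequaliser ::
  "('a, 'm) monoid_scheme \<Rightarrow> ('b, 'n) monoid_scheme \<Rightarrow> ('a \<Rightarrow> 'b) \<Rightarrow> ('a \<Rightarrow> 'b) \<Rightarrow>
    ('d, 'l) monoid_scheme \<Rightarrow> ('b \<Rightarrow> 'd) \<Rightarrow> bool" where
  "coequaliser A B g h (D :: ('d, 'l) monoid_scheme) (c :: 'b \<Rightarrow> 'd) \<longleftrightarrow>
     coequaliser_for TYPE('d) A B g h D c \<and> coequaliser_for TYPE('b set) A B g h D c"


lemma mon_homD:
  assumes "h \<in> mon_hom G H"
  shows "x \<in> carrier G \<Longrightarrow> h x \<in> carrier H"
    and "x \<in> carrier G \<Longrightarrow> y \<in> carrier G \<Longrightarrow> h (x \<otimes>\<^bsub>G\<^esub> y) = h x \<otimes>\<^bsub>H\<^esub> h y"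
    and "h \<one>\<^bsub>G\<^esub> = \<one>\<^bsub>H\<^esub>"
  using assms by (auto simp: mon_hom_def hom_def)

lemma mon_homI:
  assumes "\<And>x. x \<in> carrier G \<Longrightarrow> h x \<in> carrier H"
    and "\<And>x y. x \<in> carrier G \<Longrightarrow> y \<in> carrier G \<Longrightarrow> h (x \<otimes>\<^bsub>G\<^esub> y) = h x \<otimes>\<^bsub>H\<^esub> h y"
    and "h \<one>\<^bsub>G\<^esub> = \<one>\<^bsub>H\<^esub>"
  shows "h \<in> mon_hom G H"
  using assms by (auto simp: mon_hom_def hom_def)

lemma mon_hom_comp:
  assumes "h \<in> mon_hom G H" "h' \<in> mon_hom H L"
  shows "(\<lambda>x. h' (h x)) \<in> mon_hom G L"
  using mon_homD[OF assms(1)] mon_homD[OF assms(2)] by (auto intro!: mon_homI)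

lemma mon_hom_restrict:
  assumes "monoid G" "h \<in> mon_hom G H"
  shows "restrict h (carrier G) \<in> mon_hom G H"
proof -
  interpret monoid G by fact
  show ?thesis using mon_homD[OF assms(2)] by (auto intro!: mon_homI)
qed

lemma ex1_imp_eq: "\<exists>!x. P x \<Longrightarrow> P a \<Longrightarrow> P b \<Longrightarrow> a = b"
  by blast

text \<open>The quotient of \<open>B\<close> by the least congruence that identifies \<open>g\<close> and \<open>h\<close>.\<close>

lemma quotient_coequalises:
  fixes A :: "('a, 'm) monoid_scheme" and B :: "('b, 'n) monoid_scheme"
  assumes B: "monoid B"
    and g_fun: "g \<in> carrier A \<rightarrow> carrier B" and h_fun: "h \<in> carrier A \<rightarrow> carrier B"
  obtains Q :: "'b set monoid" and pr where
    "coequalises A B g h Q pr" "carrier Q = pr ` carrier B"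
    "\<And>E x y. \<lbrakk>equiv (carrier B) E; \<forall>x\<in>carrier A. (g x, h x) \<in> E;
        \<forall>x y u v. (x, y) \<in> E \<longrightarrow> (u, v) \<in> E \<longrightarrow> (x \<otimes>\<^bsub>B\<^esub> u, y \<otimes>\<^bsub>B\<^esub> v) \<in> E;
        x \<in> carrier B; y \<in> carrier B; pr x = pr y\<rbrakk> \<Longrightarrow> (x, y) \<in> E"
proof -
  have g: "g x \<in> carrier B" and h: "h x \<in> carrier B" if "x \<in> carrier A" for x
    using that g_fun h_fun by auto
  interpret B: monoid B by fact
  define cong where "cong E \<longleftrightarrow> equiv (carrier B) E \<and> (\<forall>x\<in>carrier A. (g x, h x) \<in> E) \<and>
    (\<forall>x y u v. (x, y) \<in> E \<longrightarrow> (u, v) \<in> E \<longrightarrow> (x \<otimes>\<^bsub>B\<^esub> u, y \<otimes>\<^bsub>B\<^esub> v) \<in> E)" for E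
  define \<theta> where "\<theta> = {(x, y). x \<in> carrier B \<and> y \<in> carrier B \<and> (\<forall>E. cong E \<longrightarrow> (x, y) \<in> E)}"
  have equiv: "equiv (carrier B) \<theta>"
  proof (rule equivI)
    show "\<theta> \<subseteq> carrier B \<times> carrier B" by (auto simp: \<theta>_def)
    show "refl_on (carrier B) \<theta>"
      by (auto simp: refl_on_def \<theta>_def cong_def equiv_def)
    show "sym \<theta>" by (auto simp: sym_def \<theta>_def cong_def equiv_def)
    show "trans \<theta>"
    proof (rule transI)
      fix x y z assume xyz: "(x, y) \<in> \<theta>" "(y, z) \<in> \<theta>"
      have "(x, z) \<in> E" if "cong E" for E
      proof -
        have "trans E" using that by (simp add: cong_def equiv_def)
        then show ?thesis using xyz that by (auto simp: \<theta>_def elim: transE)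
      qed
      then show "(x, z) \<in> \<theta>" using xyz by (auto simp: \<theta>_def)
    qed
  qed
  have mult: "(x \<otimes>\<^bsub>B\<^esub> u, y \<otimes>\<^bsub>B\<^esub> v) \<in> \<theta>" if "(x, y) \<in> \<theta>" "(u, v) \<in> \<theta>" for x y u v
    using that by (auto simp: \<theta>_def cong_def)
  have gh: "(g x, h x) \<in> \<theta>" if "x \<in> carrier A" for x
    using that g h by (auto simp: \<theta>_def cong_def)
  define pr where "pr x = \<theta> `` {x}" for x
  define Q where "Q = \<lparr>carrier = carrier B // \<theta>,
    mult = (\<lambda>U V. \<Union>u\<in>U. \<Union>v\<in>V. \<theta> `` {u \<otimes>\<^bsub>B\<^esub> v}), one = pr \<one>\<^bsub>B\<^esub>\<rparr>"
  have carQ: "carrier Q = pr ` carrier B" by (auto simp: Q_def pr_def quotient_def)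
  have pr_eq: "pr x = pr y \<longleftrightarrow> (x, y) \<in> \<theta>" if "x \<in> carrier B" "y \<in> carrier B" for x y
    unfolding pr_def using eq_equiv_class_iff[OF equiv] that by blast
  have pr_mult: "pr x \<otimes>\<^bsub>Q\<^esub> pr y = pr (x \<otimes>\<^bsub>B\<^esub> y)" if "x \<in> carrier B" "y \<in> carrier B" for x y
  proof -
    have "congruent2 \<theta> \<theta> (\<lambda>u v. \<theta> `` {u \<otimes>\<^bsub>B\<^esub> v})"
      unfolding congruent2_def by (clarify, rule equiv_class_eq[OF equiv mult])
    then show ?thesis
      using UN_equiv_class2[OF equiv equiv] that by (simp add: Q_def pr_def)
  qed
  have oneQ: "\<one>\<^bsub>Q\<^esub> = pr \<one>\<^bsub>B\<^esub>" by (simp add: Q_def)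
  have mQ: "monoid Q"
    by (rule monoidI) (auto simp: carQ oneQ pr_mult B.m_assoc)
  have pr: "pr \<in> mon_hom B Q"
    by (rule mon_homI) (auto simp: carQ oneQ pr_mult)
  show thesis
  proof (rule that[of Q pr])
    show "coequalises A B g h Q pr"
      using mQ pr gh g h by (simp add: coequalises_def pr_eq)
    show "carrier Q = pr ` carrier B" by (rule carQ)
    fix E x y
    assume "equiv (carrier B) E" "\<forall>x\<in>carrier A. (g x, h x) \<in> E"
      and "\<forall>x y u v. (x, y) \<in> E \<longrightarrow> (u, v) \<in> E \<longrightarrow> (x \<otimes>\<^bsub>B\<^esub> u, y \<otimes>\<^bsub>B\<^esub> v) \<in> E"
      and xy: "x \<in> carrier B" "y \<in> carrier B" "pr x = pr y"
    then have "cong E" by (simp add: cong_def)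
    moreover have "(x, y) \<in> \<theta>" using xy pr_eq by simp
    ultimately show "(x, y) \<in> E" by (simp add: \<theta>_def)
  qed
qed

lemma coequaliser_universal:
  fixes D :: "('d, 'l) monoid_scheme" and Z :: "('z, 'o) monoid_scheme"
    and A :: "('a, 'm) monoid_scheme" and B :: "('b, 'n) monoid_scheme"
  assumes B: "monoid B"
    and g_fun: "g \<in> carrier A \<rightarrow> carrier B" and h_fun: "h \<in> carrier A \<rightarrow> carrier B"
    and co: "coequaliser A B g h D c"
  shows coequaliser_surj: "c ` carrier B = carrier D"
    and "coequalises A B g h Z t \<Longrightarrow>
      \<exists>!e. e \<in> mon_hom D Z \<inter> extensional (carrier D) \<and> (\<forall>x\<in>carrier B. e (c x) = t x)"
proof -
  have g: "g x \<in> carrier B" and h: "h x \<in> carrier B" if "x \<in> carrier A" for x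
    using that g_fun h_fun by auto
  obtain Q :: "'b set monoid" and pr where pr: "coequalises A B g h Q pr"
    and carQ: "carrier Q = pr ` carrier B"
    and least: "\<And>E x y. \<lbrakk>equiv (carrier B) E; \<forall>x\<in>carrier A. (g x, h x) \<in> E;
        \<forall>x y u v. (x, y) \<in> E \<longrightarrow> (u, v) \<in> E \<longrightarrow> (x \<otimes>\<^bsub>B\<^esub> u, y \<otimes>\<^bsub>B\<^esub> v) \<in> E;
        x \<in> carrier B; y \<in> carrier B; pr x = pr y\<rbrakk> \<Longrightarrow> (x, y) \<in> E"
    by (fact quotient_coequalises[OF B g_fun h_fun])
  interpret B: monoid B by fact
  have prh: "pr \<in> mon_hom B Q" using pr by (simp add: coequalises_def)
  have c: "coequalises A B g h D c" using co by (simp add: coequaliser_def coequaliser_for_def)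
  then have ch: "c \<in> mon_hom B D" and D: "monoid D" by (simp_all add: coequalises_def)
  interpret D: monoid D by (rule D)
  have factor: "\<exists>t'. t' \<in> mon_hom Q Z \<and> (\<forall>x\<in>carrier B. t' (pr x) = t x)"
    if t: "coequalises A B g h Z t" for t and Z :: "('zz, 'oo) monoid_scheme"
  proof -
    have th: "t \<in> mon_hom B Z" and teq: "\<forall>x\<in>carrier A. t (g x) = t (h x)"
      using t by (simp_all add: coequalises_def)
    have *: "t x = t y" if "x \<in> carrier B" "y \<in> carrier B" "pr x = pr y" for x y
    proof -
      have "equiv (carrier B) {(x, y). x \<in> carrier B \<and> y \<in> carrier B \<and> t x = t y}"
        by (rule equivI) (auto simp: refl_on_def sym_def trans_def)
      from least[OF this _ _ that] show ?thesis
        using teq g h mon_homD[OF th] by auto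
    qed
    define t' where "t' U = t (SOME x. x \<in> carrier B \<and> pr x = U)" for U
    have t'pr: "t' (pr x) = t x" if "x \<in> carrier B" for x
    proof -
      have "(SOME y. y \<in> carrier B \<and> pr y = pr x) \<in> carrier B
        \<and> pr (SOME y. y \<in> carrier B \<and> pr y = pr x) = pr x"
        by (rule someI[of "\<lambda>y. y \<in> carrier B \<and> pr y = pr x" x]) (use that in simp)
      then show ?thesis unfolding t'_def using that by (intro *) auto
    qed
    have "t' \<in> mon_hom Q Z"
    proof (rule mon_homI)
      show "t' U \<in> carrier Z" if "U \<in> carrier Q" for U
        using that mon_homD[OF th] by (auto simp: carQ t'pr)
      show "t' (U \<otimes>\<^bsub>Q\<^esub> V) = t' U \<otimes>\<^bsub>Z\<^esub> t' V" if UV: "U \<in> carrier Q" "V \<in> carrier Q" for U V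
      proof -
        obtain x y where xy: "x \<in> carrier B" "y \<in> carrier B" "U = pr x" "V = pr y"
          using UV by (auto simp: carQ)
        have "t' (U \<otimes>\<^bsub>Q\<^esub> V) = t' (pr (x \<otimes>\<^bsub>B\<^esub> y))"
          using xy mon_homD(2)[OF prh, of x y] by simp
        then show ?thesis using xy mon_homD[OF th] by (simp add: t'pr)
      qed
      show "t' \<one>\<^bsub>Q\<^esub> = \<one>\<^bsub>Z\<^esub>"
        using t'pr[of "\<one>\<^bsub>B\<^esub>"] mon_homD(3)[OF prh] mon_homD(3)[OF th] by simp
    qed
    then show ?thesis using t'pr by blast
  qed
  obtain e where e: "e \<in> mon_hom D Q" "\<And>x. x \<in> carrier B \<Longrightarrow> e (c x) = pr x"
    using co pr unfolding coequaliser_def coequaliser_for_def by blast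
  obtain c' where c': "c' \<in> mon_hom Q D" "\<And>x. x \<in> carrier B \<Longrightarrow> c' (pr x) = c x"
    using factor[OF c] by blast
  have id: "c' (e d) = d" if d: "d \<in> carrier D" for d
  proof -
    let ?D = "monoid.truncate D"
    have tr: "mon_hom D ?D = mon_hom D D" "mon_hom B ?D = mon_hom B D" "carrier ?D = carrier D"
      by (simp_all add: monoid.defs mon_hom_def hom_def)
    have "monoid ?D"
      by (rule monoidI) (auto simp: monoid.defs D.m_assoc)
    then have "coequalises A B g h ?D c"
      using c tr by (simp add: coequalises_def)
    then have ex1: "\<exists>!i. i \<in> mon_hom D D \<inter> extensional (carrier D) \<and> (\<forall>x\<in>carrier B. i (c x) = c x)"
      using co tr unfolding coequaliser_def coequaliser_for_def by metis
    have 1: "restrict (\<lambda>d. c' (e d)) (carrier D) \<in> mon_hom D D"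
      by (rule mon_hom_restrict[OF D mon_hom_comp[OF e(1) c'(1)]])
    have 2: "restrict (\<lambda>d. d) (carrier D) \<in> mon_hom D D"
      by (rule mon_homI) auto
    have "restrict (\<lambda>d. c' (e d)) (carrier D) = restrict (\<lambda>d. d) (carrier D)"
    proof (rule ex1_imp_eq[OF ex1])
      show "restrict (\<lambda>d. c' (e d)) (carrier D) \<in> mon_hom D D \<inter> extensional (carrier D) \<and>
        (\<forall>x\<in>carrier B. restrict (\<lambda>d. c' (e d)) (carrier D) (c x) = c x)"
        using 1 mon_homD(1)[OF ch] by (simp add: e(2) c'(2))
      show "restrict (\<lambda>d. d) (carrier D) \<in> mon_hom D D \<inter> extensional (carrier D) \<and>
        (\<forall>x\<in>carrier B. restrict (\<lambda>d. d) (carrier D) (c x) = c x)"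
        using 2 mon_homD(1)[OF ch] by simp
    qed
    from fun_cong[OF this, of d] show ?thesis using d by simp
  qed
  show surj: "c ` carrier B = carrier D"
  proof
    show "c ` carrier B \<subseteq> carrier D" using mon_homD(1)[OF ch] by auto
    show "carrier D \<subseteq> c ` carrier B"
    proof
      fix d assume d: "d \<in> carrier D"
      then obtain x where "x \<in> carrier B" "e d = pr x"
        using mon_homD(1)[OF e(1)] by (auto simp: carQ)
      then show "d \<in> c ` carrier B" using id[OF d] c'(2) by auto
    qed
  qed
  assume t: "coequalises A B g h Z t"
  obtain t' where t': "t' \<in> mon_hom Q Z" "\<And>x. x \<in> carrier B \<Longrightarrow> t' (pr x) = t x"
    using factor[OF t] by blast
  show "\<exists>!e. e \<in> mon_hom D Z \<inter> extensional (carrier D) \<and> (\<forall>x\<in>carrier B. e (c x) = t x)"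
  proof (rule ex1I[of _ "restrict (\<lambda>d. t' (e d)) (carrier D)"])
    show "restrict (\<lambda>d. t' (e d)) (carrier D) \<in> mon_hom D Z \<inter> extensional (carrier D) \<and>
      (\<forall>x\<in>carrier B. restrict (\<lambda>d. t' (e d)) (carrier D) (c x) = t x)"
      using mon_hom_restrict[OF D mon_hom_comp[OF e(1) t'(1)]] mon_homD(1)[OF ch]
      by (auto simp: e(2) t'(2))
    fix i assume i: "i \<in> mon_hom D Z \<inter> extensional (carrier D) \<and> (\<forall>x\<in>carrier B. i (c x) = t x)"
    show "i = restrict (\<lambda>d. t' (e d)) (carrier D)"
    proof (rule extensionalityI[of _ "carrier D"])
      fix d assume d: "d \<in> carrier D"
      then obtain x where "x \<in> carrier B" "d = c x" using surj by auto
      then show "i d = restrict (\<lambda>d. t' (e d)) (carrier D) d"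
        using i d by (simp add: e(2) t'(2))
    qed (use i in auto)
  qed
qed


section \<open>Schreier extensions and Schreier points\<close>

definition monoid_extension ::
  "('k, 'p) monoid_scheme \<Rightarrow> ('x, 'q) monoid_scheme \<Rightarrow> ('m, 'r) monoid_scheme \<Rightarrow>
    ('k \<Rightarrow> 'x) \<Rightarrow> ('x \<Rightarrow> 'm) \<Rightarrow> bool" where
  "monoid_extension K X M k f \<longleftrightarrow>
     monoid K \<and> monoid X \<and> monoid M \<and>
     f \<in> mon_hom X M \<and> f ` carrier X = carrier M \<and> is_kernel K X M k f"

definition fibre :: "('x, 'q) monoid_scheme \<Rightarrow> ('x \<Rightarrow> 'm) \<Rightarrow> 'm \<Rightarrow> 'x set" where
  "fibre X f m = {x \<in> carrier X. f x = m}"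

definition representatives ::
  "('k, 'p) monoid_scheme \<Rightarrow> ('x, 'q) monoid_scheme \<Rightarrow> ('k \<Rightarrow> 'x) \<Rightarrow> ('x \<Rightarrow> 'm) \<Rightarrow> 'm \<Rightarrow> 'x set" where
  "representatives K X k f m =
     {u \<in> fibre X f m. \<forall>x\<in>fibre X f m. \<exists>!a. a \<in> carrier K \<and> x = k a \<otimes>\<^bsub>X\<^esub> u}"

definition schreier_extension ::
  "('k, 'p) monoid_scheme \<Rightarrow> ('x, 'q) monoid_scheme \<Rightarrow> ('m, 'r) monoid_scheme \<Rightarrow>
    ('k \<Rightarrow> 'x) \<Rightarrow> ('x \<Rightarrow> 'm) \<Rightarrow> bool" where
  "schreier_extension K X M k f \<longleftrightarrow>
     monoid_extension K X M k f \<and> (\<forall>m\<in>carrier M. representatives K X k f m \<noteq> {})"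

text \<open>The action \<open>m \<ast> a\<close> of \<open>M\<close> on \<open>K\<close> (for \<open>K\<close> commutative and cancellative).\<close>

definition extension_action ::
  "('k, 'p) monoid_scheme \<Rightarrow> ('x, 'q) monoid_scheme \<Rightarrow> ('k \<Rightarrow> 'x) \<Rightarrow> ('x \<Rightarrow> 'm) \<Rightarrow> 'm \<Rightarrow> 'k \<Rightarrow> 'k" where
  "extension_action K X k f m a =
     (THE b. b \<in> carrier K \<and> (\<forall>u\<in>representatives K X k f m. u \<otimes>\<^bsub>X\<^esub> k a = k b \<otimes>\<^bsub>X\<^esub> u))"

definition split_extension ::
  "('k, 'p) monoid_scheme \<Rightarrow> ('b, 'q) monoid_scheme \<Rightarrow> ('m, 'r) monoid_scheme \<Rightarrow>
    ('k \<Rightarrow> 'b) \<Rightarrow> ('b \<Rightarrow> 'm) \<Rightarrow> ('m \<Rightarrow> 'b) \<Rightarrow> bool" where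
  "split_extension K B M k f s \<longleftrightarrow>
     monoid_extension K B M k f \<and> s \<in> mon_hom M B \<and> (\<forall>m\<in>carrier M. f (s m) = m)"

definition is_schreier_retraction ::
  "('k, 'p) monoid_scheme \<Rightarrow> ('b, 'q) monoid_scheme \<Rightarrow>
    ('k \<Rightarrow> 'b) \<Rightarrow> ('b \<Rightarrow> 'm) \<Rightarrow> ('m \<Rightarrow> 'b) \<Rightarrow> ('b \<Rightarrow> 'k) \<Rightarrow> bool" where
  "is_schreier_retraction K B k f s q \<longleftrightarrow>
     q \<in> carrier B \<rightarrow> carrier K \<and> (\<forall>b\<in>carrier B. b = k (q b) \<otimes>\<^bsub>B\<^esub> s (f b))"

definition schreier_point ::
  "('k, 'p) monoid_scheme \<Rightarrow> ('b, 'q) monoid_scheme \<Rightarrow> ('m, 'r) monoid_scheme \<Rightarrow>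
    ('k \<Rightarrow> 'b) \<Rightarrow> ('b \<Rightarrow> 'm) \<Rightarrow> ('m \<Rightarrow> 'b) \<Rightarrow> bool" where
  "schreier_point K B M k f s \<longleftrightarrow>
     split_extension K B M k f s \<and>
     (\<exists>!q. q \<in> extensional (carrier B) \<and> is_schreier_retraction K B k f s q)"


section \<open>The Schreier point associated with a Schreier extension\<close>

definition R_set :: "('k, 'p) monoid_scheme \<Rightarrow> ('x, 'q) monoid_scheme \<Rightarrow> ('k \<Rightarrow> 'x) \<Rightarrow> ('x \<times> 'x) set" where
  "R_set K X k = {(x, k a \<otimes>\<^bsub>X\<^esub> x) | x a. x \<in> carrier X \<and> a \<in> carrier K}"

definition P_set ::
  "('k, 'p) monoid_scheme \<Rightarrow> ('x, 'q) monoid_scheme \<Rightarrow> ('k \<Rightarrow> 'x) \<Rightarrow> ('x \<times> 'x \<times> 'x) set" where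
  "P_set K X k =
     {(x, k a \<otimes>\<^bsub>X\<^esub> x, k b \<otimes>\<^bsub>X\<^esub> k a \<otimes>\<^bsub>X\<^esub> x) | x a b.
        x \<in> carrier X \<and> a \<in> carrier K \<and> b \<in> carrier K}"

definition R_monoid ::
  "('k, 'p) monoid_scheme \<Rightarrow> ('x, 'q) monoid_scheme \<Rightarrow> ('k \<Rightarrow> 'x) \<Rightarrow> ('x \<times> 'x) monoid" where
  "R_monoid K X k = (X \<times>\<times> X)\<lparr>carrier := R_set K X k\<rparr>"

definition P_monoid ::
  "('k, 'p) monoid_scheme \<Rightarrow> ('x, 'q) monoid_scheme \<Rightarrow> ('k \<Rightarrow> 'x) \<Rightarrow> ('x \<times> 'x \<times> 'x) monoid" where
  "P_monoid K X k = (X \<times>\<times> X \<times>\<times> X)\<lparr>carrier := P_set K X k\<rparr>"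

definition pi1 ::
  "('k, 'p) monoid_scheme \<Rightarrow> ('x, 'q) monoid_scheme \<Rightarrow> ('k \<Rightarrow> 'x) \<Rightarrow> 'x \<times> 'x \<times> 'x \<Rightarrow> 'x \<times> 'x" where
  "pi1 K X k t =
     (THE r. \<exists>x\<in>carrier X. \<exists>a\<in>carrier K. \<exists>b\<in>carrier K.
        t = (x, k a \<otimes>\<^bsub>X\<^esub> x, k b \<otimes>\<^bsub>X\<^esub> k a \<otimes>\<^bsub>X\<^esub> x) \<and> r = (x, k b \<otimes>\<^bsub>X\<^esub> x))"

definition p2 :: "'x \<times> 'x \<times> 'x \<Rightarrow> 'x \<times> 'x" where
  "p2 = (\<lambda>(x, y, z). (y, z))"

definition is_df ::
  "('k, 'p) monoid_scheme \<Rightarrow> ('x, 'q) monoid_scheme \<Rightarrow> ('k \<Rightarrow> 'x) \<Rightarrow>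
    ('d, 'l) monoid_scheme \<Rightarrow> ('x \<times> 'x \<Rightarrow> 'd) \<Rightarrow> bool" where
  "is_df K X k df \<gamma> \<longleftrightarrow>
     coequaliser (P_monoid K X k) (R_monoid K X k) (pi1 K X k) p2 df \<gamma>"

definition fbar ::
  "('k, 'p) monoid_scheme \<Rightarrow> ('x, 'q) monoid_scheme \<Rightarrow> ('k \<Rightarrow> 'x) \<Rightarrow> ('x \<Rightarrow> 'm) \<Rightarrow>
    ('x \<times> 'x \<Rightarrow> 'd) \<Rightarrow> 'd \<Rightarrow> 'm" where
  "fbar K X k f \<gamma> d =
     (THE m. \<exists>x\<in>carrier X. \<exists>a\<in>carrier K. d = \<gamma> (x, k a \<otimes>\<^bsub>X\<^esub> x) \<and> m = f x)"

definition sbar ::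
  "('x, 'q) monoid_scheme \<Rightarrow> ('x \<Rightarrow> 'm) \<Rightarrow> ('x \<times> 'x \<Rightarrow> 'd) \<Rightarrow> 'm \<Rightarrow> 'd" where
  "sbar X f \<gamma> m = (THE d. \<exists>x\<in>carrier X. f x = m \<and> d = \<gamma> (x, x))"

definition kbar ::
  "('x, 'q) monoid_scheme \<Rightarrow> ('k \<Rightarrow> 'x) \<Rightarrow> ('x \<times> 'x \<Rightarrow> 'd) \<Rightarrow> 'k \<Rightarrow> 'd" where
  "kbar X k \<gamma> a = \<gamma> (\<one>\<^bsub>X\<^esub>, k a)"

definition qbar ::
  "('k, 'p) monoid_scheme \<Rightarrow> ('x, 'q) monoid_scheme \<Rightarrow> ('k \<Rightarrow> 'x) \<Rightarrow>
    ('x \<times> 'x \<Rightarrow> 'd) \<Rightarrow> 'd \<Rightarrow> 'k" where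
  "qbar K X k \<gamma> d = (THE a. a \<in> carrier K \<and> (\<exists>x\<in>carrier X. d = \<gamma> (x, k a \<otimes>\<^bsub>X\<^esub> x)))"


section \<open>The construction is well defined\<close>

text \<open>
  The definite descriptions above are meaningful, the diagram is one of monoids and homomorphisms,
  and \<open>df\<close> is a Schreier point with retraction \<^const>\<open>qbar\<close>.
\<close>

locale schreier =
  fixes K :: "('k, 'p) monoid_scheme" and X :: "('x, 'q) monoid_scheme" and M :: "('m, 'r) monoid_scheme"
    and k :: "'k \<Rightarrow> 'x" and f :: "'x \<Rightarrow> 'm"
  assumes ext: "schreier_extension K X M k f"
    and comm_cancel: "comm_monoid_cancel K"
begin

sublocale K: comm_monoid_cancel K by (rule comm_cancel)
sublocale X: monoid X using ext by (simp add: schreier_extension_def monoid_extension_def)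
sublocale M: monoid M using ext by (simp add: schreier_extension_def monoid_extension_def)

lemma f_hom: "f \<in> mon_hom X M" and f_surj: "f ` carrier X = carrier M"
  using ext by (simp_all add: schreier_extension_def monoid_extension_def)

lemma f_closed [simp]: "x \<in> carrier X \<Longrightarrow> f x \<in> carrier M" using mon_homD[OF f_hom] by simp
lemma f_mult [simp]: "x \<in> carrier X \<Longrightarrow> y \<in> carrier X \<Longrightarrow> f (x \<otimes>\<^bsub>X\<^esub> y) = f x \<otimes>\<^bsub>M\<^esub> f y"
  using mon_homD[OF f_hom] by simp
lemma f_one [simp]: "f \<one>\<^bsub>X\<^esub> = \<one>\<^bsub>M\<^esub>" using mon_homD[OF f_hom] by simp

lemma k_iso: "k \<in> iso K (X\<lparr>carrier := kernel X M f\<rparr>)"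
  using ext by (simp add: schreier_extension_def monoid_extension_def is_kernel_def)

lemma k_image: "k ` carrier K = {x \<in> carrier X. f x = \<one>\<^bsub>M\<^esub>}"
  using k_iso by (simp add: iso_def bij_betw_def kernel_def)
lemma k_inj: "inj_on k (carrier K)"
  using k_iso by (simp add: iso_def bij_betw_def)
lemma k_closed [simp]: "a \<in> carrier K \<Longrightarrow> k a \<in> carrier X"
  and f_k [simp]: "a \<in> carrier K \<Longrightarrow> f (k a) = \<one>\<^bsub>M\<^esub>"
  using k_image by auto
lemma k_mult [simp]: "a \<in> carrier K \<Longrightarrow> b \<in> carrier K \<Longrightarrow> k (a \<otimes>\<^bsub>K\<^esub> b) = k a \<otimes>\<^bsub>X\<^esub> k b"
  using k_iso by (auto simp: iso_def hom_def)
lemma k_one [simp]: "k \<one>\<^bsub>K\<^esub> = \<one>\<^bsub>X\<^esub>"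
proof -
  have "\<one>\<^bsub>X\<^esub> \<in> k ` carrier K" by (simp add: k_image)
  then obtain e where e: "e \<in> carrier K" "k e = \<one>\<^bsub>X\<^esub>" by auto
  have "k \<one>\<^bsub>K\<^esub> = k \<one>\<^bsub>K\<^esub> \<otimes>\<^bsub>X\<^esub> k e" using e by simp
  also have "\<dots> = k (\<one>\<^bsub>K\<^esub> \<otimes>\<^bsub>K\<^esub> e)" by (simp only: k_mult K.one_closed e)
  also have "\<dots> = \<one>\<^bsub>X\<^esub>" using e by simp
  finally show ?thesis .
qed

abbreviation rep where "rep \<equiv> representatives K X k f"

lemma rep_ex: "m \<in> carrier M \<Longrightarrow> \<exists>u. u \<in> rep m"
  using ext by (auto simp: schreier_extension_def)
lemma rep_closed: "u \<in> rep m \<Longrightarrow> u \<in> carrier X" and rep_f: "u \<in> rep m \<Longrightarrow> f u = m"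
  by (auto simp: representatives_def fibre_def)
lemma rep_ex1: "u \<in> rep m \<Longrightarrow> x \<in> carrier X \<Longrightarrow> f x = m \<Longrightarrow> \<exists>!a. a \<in> carrier K \<and> x = k a \<otimes>\<^bsub>X\<^esub> u"
  by (auto simp: representatives_def fibre_def)

lemma decomp:
  assumes "x \<in> carrier X"
  obtains c u where "c \<in> carrier K" "u \<in> rep (f x)" "x = k c \<otimes>\<^bsub>X\<^esub> u"
  using rep_ex[of "f x"] rep_ex1[OF _ assms] assms by (metis f_closed)

lemma rep_cancel:
  assumes "u \<in> rep m" "a \<in> carrier K" "b \<in> carrier K" "k a \<otimes>\<^bsub>X\<^esub> u = k b \<otimes>\<^bsub>X\<^esub> u"
  shows "a = b"
proof -
  have m: "m \<in> carrier M" using assms(1) rep_f rep_closed f_closed by metis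
  have "f (k a \<otimes>\<^bsub>X\<^esub> u) = m" using assms rep_closed rep_f m by simp
  with rep_ex1[OF assms(1), of "k a \<otimes>\<^bsub>X\<^esub> u"] show ?thesis
    using assms rep_closed by (metis X.m_closed k_closed)
qed

lemma k_cancel:
  assumes x: "x \<in> carrier X" and a: "a \<in> carrier K" "b \<in> carrier K" "k a \<otimes>\<^bsub>X\<^esub> x = k b \<otimes>\<^bsub>X\<^esub> x"
  shows "a = b"
proof -
  obtain c u where c: "c \<in> carrier K" "u \<in> rep (f x)" "x = k c \<otimes>\<^bsub>X\<^esub> u" using decomp[OF x] .
  note u = rep_closed[OF c(2)]
  have "k (a \<otimes>\<^bsub>K\<^esub> c) \<otimes>\<^bsub>X\<^esub> u = k (b \<otimes>\<^bsub>K\<^esub> c) \<otimes>\<^bsub>X\<^esub> u"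
    using a c u by (simp add: X.m_assoc)
  from rep_cancel[OF c(2) _ _ this] have "a \<otimes>\<^bsub>K\<^esub> c = b \<otimes>\<^bsub>K\<^esub> c" using a c by simp
  then show ?thesis using K.r_cancel a c by blast
qed

lemma k_comm:
  assumes "a \<in> carrier K" "b \<in> carrier K" "x \<in> carrier X"
  shows "k a \<otimes>\<^bsub>X\<^esub> (k b \<otimes>\<^bsub>X\<^esub> x) = k b \<otimes>\<^bsub>X\<^esub> (k a \<otimes>\<^bsub>X\<^esub> x)"
proof -
  have "k (a \<otimes>\<^bsub>K\<^esub> b) \<otimes>\<^bsub>X\<^esub> x = k (b \<otimes>\<^bsub>K\<^esub> a) \<otimes>\<^bsub>X\<^esub> x"
    using assms by (simp only: K.m_comm)
  then show ?thesis using assms by (simp add: X.m_assoc)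
qed

lemma act_aux:
  assumes m: "m \<in> carrier M" and a: "a \<in> carrier K"
  obtains b where "b \<in> carrier K" "\<And>x. x \<in> carrier X \<Longrightarrow> f x = m \<Longrightarrow> x \<otimes>\<^bsub>X\<^esub> k a = k b \<otimes>\<^bsub>X\<^esub> x"
proof -
  obtain u where u: "u \<in> rep m" using rep_ex[OF m] by blast
  note uX = rep_closed[OF u] and fu = rep_f[OF u]
  obtain b where b: "b \<in> carrier K" "u \<otimes>\<^bsub>X\<^esub> k a = k b \<otimes>\<^bsub>X\<^esub> u"
    using rep_ex1[OF u, of "u \<otimes>\<^bsub>X\<^esub> k a"] uX fu a m by auto
  show thesis
  proof (rule that[OF b(1)])
    fix x assume x: "x \<in> carrier X" "f x = m"
    obtain c where c: "c \<in> carrier K" "x = k c \<otimes>\<^bsub>X\<^esub> u" using rep_ex1[OF u x] by blast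
    have "x \<otimes>\<^bsub>X\<^esub> k a = k c \<otimes>\<^bsub>X\<^esub> (k b \<otimes>\<^bsub>X\<^esub> u)" using c uX a b by (simp add: X.m_assoc)
    also have "\<dots> = k b \<otimes>\<^bsub>X\<^esub> x" using c uX b by (simp add: k_comm)
    finally show "x \<otimes>\<^bsub>X\<^esub> k a = k b \<otimes>\<^bsub>X\<^esub> x" .
  qed
qed

abbreviation act where "act \<equiv> extension_action K X k f"

lemma act:
  assumes m: "m \<in> carrier M" and a: "a \<in> carrier K"
  shows act_closed [simp]: "act m a \<in> carrier K"
    and act_eq: "\<And>x. x \<in> carrier X \<Longrightarrow> f x = m \<Longrightarrow> x \<otimes>\<^bsub>X\<^esub> k a = k (act m a) \<otimes>\<^bsub>X\<^esub> x"
    and act_uniq: "\<And>x b. x \<in> carrier X \<Longrightarrow> f x = m \<Longrightarrow> b \<in> carrier K \<Longrightarrow>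
        x \<otimes>\<^bsub>X\<^esub> k a = k b \<otimes>\<^bsub>X\<^esub> x \<Longrightarrow> act m a = b"
proof -
  obtain b where b: "b \<in> carrier K" "\<And>x. x \<in> carrier X \<Longrightarrow> f x = m \<Longrightarrow> x \<otimes>\<^bsub>X\<^esub> k a = k b \<otimes>\<^bsub>X\<^esub> x"
    using act_aux[OF m a] by blast
  obtain u where u: "u \<in> rep m" using rep_ex[OF m] by blast
  have "act m a = b"
    unfolding extension_action_def
  proof (rule the_equality)
    show "b \<in> carrier K \<and> (\<forall>u\<in>rep m. u \<otimes>\<^bsub>X\<^esub> k a = k b \<otimes>\<^bsub>X\<^esub> u)"
      using b rep_closed rep_f by blast
    fix b' assume "b' \<in> carrier K \<and> (\<forall>u\<in>rep m. u \<otimes>\<^bsub>X\<^esub> k a = k b' \<otimes>\<^bsub>X\<^esub> u)"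
    then show "b' = b" using rep_cancel[OF u] b u rep_closed rep_f by metis
  qed
  with b show "act m a \<in> carrier K"
    and eq: "\<And>x. x \<in> carrier X \<Longrightarrow> f x = m \<Longrightarrow> x \<otimes>\<^bsub>X\<^esub> k a = k (act m a) \<otimes>\<^bsub>X\<^esub> x"
    by auto
  then show "\<And>x b. x \<in> carrier X \<Longrightarrow> f x = m \<Longrightarrow> b \<in> carrier K \<Longrightarrow>
        x \<otimes>\<^bsub>X\<^esub> k a = k b \<otimes>\<^bsub>X\<^esub> x \<Longrightarrow> act m a = b"
    using k_cancel by metis
qed

lemma f_ex: "m \<in> carrier M \<Longrightarrow> \<exists>x\<in>carrier X. f x = m"
proof -
  assume "m \<in> carrier M"
  then have "m \<in> f ` carrier X" by (simp only: f_surj)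
  then show ?thesis by blast
qed

lemma act_one: "a \<in> carrier K \<Longrightarrow> act \<one>\<^bsub>M\<^esub> a = a"
  by (rule act_uniq[of _ _ "\<one>\<^bsub>X\<^esub>"]) auto

lemma act_unit: assumes "m \<in> carrier M" shows "act m \<one>\<^bsub>K\<^esub> = \<one>\<^bsub>K\<^esub>"
proof -
  obtain x where "x \<in> carrier X" "f x = m" using f_ex assms by blast
  then show ?thesis using assms by (intro act_uniq[of _ _ x]) auto
qed

lemma act_add:
  assumes "m \<in> carrier M" "a \<in> carrier K" "b \<in> carrier K"
  shows "act m (a \<otimes>\<^bsub>K\<^esub> b) = act m a \<otimes>\<^bsub>K\<^esub> act m b"
proof -
  obtain x where x: "x \<in> carrier X" "f x = m" using f_ex assms(1) by blast
  have "x \<otimes>\<^bsub>X\<^esub> k (a \<otimes>\<^bsub>K\<^esub> b) = (x \<otimes>\<^bsub>X\<^esub> k a) \<otimes>\<^bsub>X\<^esub> k b" using assms x by (simp add: X.m_assoc)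
  also have "\<dots> = k (act m a) \<otimes>\<^bsub>X\<^esub> (x \<otimes>\<^bsub>X\<^esub> k b)"
    using assms x by (simp add: act_eq[of m a x] X.m_assoc)
  also have "\<dots> = k (act m a \<otimes>\<^bsub>K\<^esub> act m b) \<otimes>\<^bsub>X\<^esub> x"
    using assms x by (simp add: act_eq[of m b x] X.m_assoc)
  finally show ?thesis using assms x by (intro act_uniq[of _ _ x]) auto
qed

lemma act_mult:
  assumes "m \<in> carrier M" "n \<in> carrier M" "a \<in> carrier K"
  shows "act (m \<otimes>\<^bsub>M\<^esub> n) a = act m (act n a)"
proof -
  obtain x where x: "x \<in> carrier X" "f x = m" using f_ex assms(1) by blast
  obtain y where y: "y \<in> carrier X" "f y = n" using f_ex assms(2) by blast
  have "x \<otimes>\<^bsub>X\<^esub> y \<otimes>\<^bsub>X\<^esub> k a = x \<otimes>\<^bsub>X\<^esub> k (act n a) \<otimes>\<^bsub>X\<^esub> y"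
    using assms x y by (simp add: X.m_assoc act_eq[of n a y])
  also have "\<dots> = k (act m (act n a)) \<otimes>\<^bsub>X\<^esub> (x \<otimes>\<^bsub>X\<^esub> y)"
    using assms x y by (simp add: X.m_assoc[symmetric] act_eq[of m _ x])
  finally show ?thesis using assms x y by (intro act_uniq[of _ _ "x \<otimes>\<^bsub>X\<^esub> y"]) auto
qed

lemma R_mult:
  assumes "x \<in> carrier X" "y \<in> carrier X" "a \<in> carrier K" "b \<in> carrier K"
  shows "k a \<otimes>\<^bsub>X\<^esub> x \<otimes>\<^bsub>X\<^esub> (k b \<otimes>\<^bsub>X\<^esub> y) = k (a \<otimes>\<^bsub>K\<^esub> act (f x) b) \<otimes>\<^bsub>X\<^esub> (x \<otimes>\<^bsub>X\<^esub> y)"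
proof -
  have "k a \<otimes>\<^bsub>X\<^esub> x \<otimes>\<^bsub>X\<^esub> (k b \<otimes>\<^bsub>X\<^esub> y) = k a \<otimes>\<^bsub>X\<^esub> (x \<otimes>\<^bsub>X\<^esub> k b) \<otimes>\<^bsub>X\<^esub> y" using assms by (simp add: X.m_assoc)
  also have "\<dots> = k (a \<otimes>\<^bsub>K\<^esub> act (f x) b) \<otimes>\<^bsub>X\<^esub> (x \<otimes>\<^bsub>X\<^esub> y)"
    using assms by (simp add: act_eq[of "f x" b x] X.m_assoc)
  finally show ?thesis .
qed

abbreviation R where "R \<equiv> R_monoid K X k"
abbreviation P where "P \<equiv> P_monoid K X k"

lemma carrier_R: "carrier R = {(x, k a \<otimes>\<^bsub>X\<^esub> x) | x a. x \<in> carrier X \<and> a \<in> carrier K}"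
  by (simp add: R_monoid_def R_set_def)
lemma R_cases:
  assumes "p \<in> carrier R"
  obtains x a where "x \<in> carrier X" "a \<in> carrier K" "p = (x, k a \<otimes>\<^bsub>X\<^esub> x)"
  using assms by (auto simp: carrier_R)
lemma mult_R [simp]: "(x, y) \<otimes>\<^bsub>R\<^esub> (x', y') = (x \<otimes>\<^bsub>X\<^esub> x', y \<otimes>\<^bsub>X\<^esub> y')"
  by (simp add: R_monoid_def DirProd_def)
lemma one_R [simp]: "\<one>\<^bsub>R\<^esub> = (\<one>\<^bsub>X\<^esub>, \<one>\<^bsub>X\<^esub>)"
  by (simp add: R_monoid_def DirProd_def)
lemma R_memI [simp]: "x \<in> carrier X \<Longrightarrow> a \<in> carrier K \<Longrightarrow> (x, k a \<otimes>\<^bsub>X\<^esub> x) \<in> carrier R"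
  by (auto simp: carrier_R)

lemma R_setI: "x \<in> carrier X \<Longrightarrow> a \<in> carrier K \<Longrightarrow> (x, k a \<otimes>\<^bsub>X\<^esub> x) \<in> R_set K X k"
  by (auto simp: R_set_def)

lemma submonoid_R: "submonoid (R_set K X k) (X \<times>\<times> X)"
proof
  show "R_set K X k \<subseteq> carrier (X \<times>\<times> X)" by (auto simp: R_set_def DirProd_def)
  show "\<one>\<^bsub>X \<times>\<times> X\<^esub> \<in> R_set K X k"
    using R_setI[OF X.one_closed K.one_closed] by (simp add: DirProd_def)
  fix p q assume "p \<in> R_set K X k" "q \<in> R_set K X k"
  then obtain x a y b where xy: "x \<in> carrier X" "y \<in> carrier X" "a \<in> carrier K" "b \<in> carrier K"
    and "p = (x, k a \<otimes>\<^bsub>X\<^esub> x)" "q = (y, k b \<otimes>\<^bsub>X\<^esub> y)" by (auto simp: R_set_def)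
  then have "p \<otimes>\<^bsub>X \<times>\<times> X\<^esub> q = (x \<otimes>\<^bsub>X\<^esub> y, k (a \<otimes>\<^bsub>K\<^esub> act (f x) b) \<otimes>\<^bsub>X\<^esub> (x \<otimes>\<^bsub>X\<^esub> y))"
    using R_mult[OF xy] by (simp add: DirProd_def del: k_mult)
  then show "p \<otimes>\<^bsub>X \<times>\<times> X\<^esub> q \<in> R_set K X k"
    using R_setI[of "x \<otimes>\<^bsub>X\<^esub> y" "a \<otimes>\<^bsub>K\<^esub> act (f x) b"] xy by (simp del: k_mult)
qed

lemma monoid_R: "monoid R"
  unfolding R_monoid_def
  by (rule submonoid.submonoid_is_monoid[OF submonoid_R])
    (auto intro: DirProd_monoid X.monoid_axioms)

lemma carrier_P: "carrier P = {(x, k a \<otimes>\<^bsub>X\<^esub> x, k b \<otimes>\<^bsub>X\<^esub> k a \<otimes>\<^bsub>X\<^esub> x) | x a b.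
    x \<in> carrier X \<and> a \<in> carrier K \<and> b \<in> carrier K}"
  by (simp add: P_monoid_def P_set_def)

lemma pi1_eq:
  assumes "x \<in> carrier X" "a \<in> carrier K" "b \<in> carrier K"
  shows "pi1 K X k (x, k a \<otimes>\<^bsub>X\<^esub> x, k b \<otimes>\<^bsub>X\<^esub> k a \<otimes>\<^bsub>X\<^esub> x) = (x, k b \<otimes>\<^bsub>X\<^esub> x)"
  unfolding pi1_def
proof (rule the_equality)
  show "\<exists>y\<in>carrier X. \<exists>a'\<in>carrier K. \<exists>b'\<in>carrier K.
      (x, k a \<otimes>\<^bsub>X\<^esub> x, k b \<otimes>\<^bsub>X\<^esub> k a \<otimes>\<^bsub>X\<^esub> x) = (y, k a' \<otimes>\<^bsub>X\<^esub> y, k b' \<otimes>\<^bsub>X\<^esub> k a' \<otimes>\<^bsub>X\<^esub> y) \<and>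
      (x, k b \<otimes>\<^bsub>X\<^esub> x) = (y, k b' \<otimes>\<^bsub>X\<^esub> y)"
    using assms by (intro bexI[of _ x] bexI[of _ a] bexI[of _ b]) simp_all
  fix r assume "\<exists>y\<in>carrier X. \<exists>a'\<in>carrier K. \<exists>b'\<in>carrier K.
      (x, k a \<otimes>\<^bsub>X\<^esub> x, k b \<otimes>\<^bsub>X\<^esub> k a \<otimes>\<^bsub>X\<^esub> x) = (y, k a' \<otimes>\<^bsub>X\<^esub> y, k b' \<otimes>\<^bsub>X\<^esub> k a' \<otimes>\<^bsub>X\<^esub> y) \<and>
      r = (y, k b' \<otimes>\<^bsub>X\<^esub> y)"
  then obtain a' b' where *: "a' \<in> carrier K" "b' \<in> carrier K" "k a \<otimes>\<^bsub>X\<^esub> x = k a' \<otimes>\<^bsub>X\<^esub> x"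
    "k b \<otimes>\<^bsub>X\<^esub> k a \<otimes>\<^bsub>X\<^esub> x = k b' \<otimes>\<^bsub>X\<^esub> k a' \<otimes>\<^bsub>X\<^esub> x" "r = (x, k b' \<otimes>\<^bsub>X\<^esub> x)" by auto
  then have "a = a'" using k_cancel assms by blast
  with * have "k b \<otimes>\<^bsub>X\<^esub> (k a \<otimes>\<^bsub>X\<^esub> x) = k b' \<otimes>\<^bsub>X\<^esub> (k a \<otimes>\<^bsub>X\<^esub> x)" using assms by (simp add: X.m_assoc)
  then have "b = b'" using k_cancel[of "k a \<otimes>\<^bsub>X\<^esub> x" b b'] assms * by simp
  with * show "r = (x, k b \<otimes>\<^bsub>X\<^esub> x)" by simp
qed

lemma pi1_closed: "pi1 K X k \<in> carrier P \<rightarrow> carrier R"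
proof
  fix t assume "t \<in> carrier P"
  then obtain x a b where t: "t = (x, k a \<otimes>\<^bsub>X\<^esub> x, k b \<otimes>\<^bsub>X\<^esub> k a \<otimes>\<^bsub>X\<^esub> x)" "x \<in> carrier X" "a \<in> carrier K" "b \<in> carrier K"
    unfolding carrier_P by blast
  then show "pi1 K X k t \<in> carrier R" by (simp add: pi1_eq)
qed

lemma p2_closed: "p2 \<in> carrier P \<rightarrow> carrier R"
proof
  fix t assume "t \<in> carrier P"
  then obtain x a b where t: "t = (x, k a \<otimes>\<^bsub>X\<^esub> x, k b \<otimes>\<^bsub>X\<^esub> k a \<otimes>\<^bsub>X\<^esub> x)" "x \<in> carrier X" "a \<in> carrier K" "b \<in> carrier K"
    unfolding carrier_P by blast
  then show "p2 t \<in> carrier R"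
    using R_memI[of "k a \<otimes>\<^bsub>X\<^esub> x" b] by (simp add: p2_def X.m_assoc)
qed

lemma P_mult:
  assumes "x \<in> carrier X" "y \<in> carrier X" "a \<in> carrier K" "b \<in> carrier K" "c \<in> carrier K" "d \<in> carrier K"
  shows "(x, k a \<otimes>\<^bsub>X\<^esub> x, k b \<otimes>\<^bsub>X\<^esub> k a \<otimes>\<^bsub>X\<^esub> x) \<otimes>\<^bsub>P\<^esub> (y, k c \<otimes>\<^bsub>X\<^esub> y, k d \<otimes>\<^bsub>X\<^esub> k c \<otimes>\<^bsub>X\<^esub> y)
    = (x \<otimes>\<^bsub>X\<^esub> y, k (a \<otimes>\<^bsub>K\<^esub> act (f x) c) \<otimes>\<^bsub>X\<^esub> (x \<otimes>\<^bsub>X\<^esub> y),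
        k (b \<otimes>\<^bsub>K\<^esub> act (f x) d) \<otimes>\<^bsub>X\<^esub> k (a \<otimes>\<^bsub>K\<^esub> act (f x) c) \<otimes>\<^bsub>X\<^esub> (x \<otimes>\<^bsub>X\<^esub> y))"
proof -
  have "k b \<otimes>\<^bsub>X\<^esub> (k a \<otimes>\<^bsub>X\<^esub> x) \<otimes>\<^bsub>X\<^esub> (k d \<otimes>\<^bsub>X\<^esub> (k c \<otimes>\<^bsub>X\<^esub> y))
     = k (b \<otimes>\<^bsub>K\<^esub> act (f x) d) \<otimes>\<^bsub>X\<^esub> (k a \<otimes>\<^bsub>X\<^esub> x \<otimes>\<^bsub>X\<^esub> (k c \<otimes>\<^bsub>X\<^esub> y))"
    using R_mult[of "k a \<otimes>\<^bsub>X\<^esub> x" "k c \<otimes>\<^bsub>X\<^esub> y" b d] assms by simp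
  then have "k b \<otimes>\<^bsub>X\<^esub> k a \<otimes>\<^bsub>X\<^esub> x \<otimes>\<^bsub>X\<^esub> (k d \<otimes>\<^bsub>X\<^esub> k c \<otimes>\<^bsub>X\<^esub> y)
     = k (b \<otimes>\<^bsub>K\<^esub> act (f x) d) \<otimes>\<^bsub>X\<^esub> k (a \<otimes>\<^bsub>K\<^esub> act (f x) c) \<otimes>\<^bsub>X\<^esub> (x \<otimes>\<^bsub>X\<^esub> y)"
    unfolding R_mult[OF assms(1,2,3,5)] using assms by (simp add: X.m_assoc)
  moreover have "k a \<otimes>\<^bsub>X\<^esub> x \<otimes>\<^bsub>X\<^esub> (k c \<otimes>\<^bsub>X\<^esub> y) = k (a \<otimes>\<^bsub>K\<^esub> act (f x) c) \<otimes>\<^bsub>X\<^esub> (x \<otimes>\<^bsub>X\<^esub> y)"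
    using assms(1,2,3,5) by (rule R_mult)
  ultimately show ?thesis by (simp add: P_monoid_def DirProd_def del: k_mult)
qed

lemma P_setI: "x \<in> carrier X \<Longrightarrow> a \<in> carrier K \<Longrightarrow> b \<in> carrier K \<Longrightarrow>
    (x, k a \<otimes>\<^bsub>X\<^esub> x, k b \<otimes>\<^bsub>X\<^esub> k a \<otimes>\<^bsub>X\<^esub> x) \<in> P_set K X k"
  by (auto simp: P_set_def)

lemma submonoid_P: "submonoid (P_set K X k) (X \<times>\<times> X \<times>\<times> X)"
proof
  show "P_set K X k \<subseteq> carrier (X \<times>\<times> X \<times>\<times> X)" by (auto simp: P_set_def DirProd_def)
  show "\<one>\<^bsub>X \<times>\<times> X \<times>\<times> X\<^esub> \<in> P_set K X k"
    using P_setI[OF X.one_closed K.one_closed K.one_closed] by (simp add: DirProd_def)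
  fix p q assume "p \<in> P_set K X k" "q \<in> P_set K X k"
  then obtain x a b y c d where xy: "x \<in> carrier X" "y \<in> carrier X"
      "a \<in> carrier K" "b \<in> carrier K" "c \<in> carrier K" "d \<in> carrier K"
    and pq: "p = (x, k a \<otimes>\<^bsub>X\<^esub> x, k b \<otimes>\<^bsub>X\<^esub> k a \<otimes>\<^bsub>X\<^esub> x)" "q = (y, k c \<otimes>\<^bsub>X\<^esub> y, k d \<otimes>\<^bsub>X\<^esub> k c \<otimes>\<^bsub>X\<^esub> y)"
    by (auto simp: P_set_def)
  have "p \<otimes>\<^bsub>X \<times>\<times> X \<times>\<times> X\<^esub> q = p \<otimes>\<^bsub>P\<^esub> q" by (simp add: P_monoid_def)
  then show "p \<otimes>\<^bsub>X \<times>\<times> X \<times>\<times> X\<^esub> q \<in> P_set K X k"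
    unfolding pq P_mult[OF xy]
    using P_setI[of "x \<otimes>\<^bsub>X\<^esub> y" "a \<otimes>\<^bsub>K\<^esub> act (f x) c" "b \<otimes>\<^bsub>K\<^esub> act (f x) d"] xy
    by (simp del: k_mult)
qed

lemma pi1_hom: "pi1 K X k \<in> mon_hom P R"
proof (rule mon_homI)
  show "pi1 K X k (t \<otimes>\<^bsub>P\<^esub> t') = pi1 K X k t \<otimes>\<^bsub>R\<^esub> pi1 K X k t'"
    if t: "t \<in> carrier P" "t' \<in> carrier P" for t t'
  proof -
    obtain x a b y c d where xy: "x \<in> carrier X" "y \<in> carrier X"
      "a \<in> carrier K" "b \<in> carrier K" "c \<in> carrier K" "d \<in> carrier K"
      and tt: "t = (x, k a \<otimes>\<^bsub>X\<^esub> x, k b \<otimes>\<^bsub>X\<^esub> k a \<otimes>\<^bsub>X\<^esub> x)" "t' = (y, k c \<otimes>\<^bsub>X\<^esub> y, k d \<otimes>\<^bsub>X\<^esub> k c \<otimes>\<^bsub>X\<^esub> y)"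
      using t by (auto simp: carrier_P)
    show ?thesis
      unfolding tt P_mult[OF xy] using xy R_mult[OF xy(1,2,4,6)] by (simp add: pi1_eq del: k_mult)
  qed
  show "pi1 K X k \<one>\<^bsub>P\<^esub> = \<one>\<^bsub>R\<^esub>"
    using pi1_eq[of "\<one>\<^bsub>X\<^esub>" "\<one>\<^bsub>K\<^esub>" "\<one>\<^bsub>K\<^esub>"] by (simp add: P_monoid_def DirProd_def)
qed (use pi1_closed in auto)

lemma p2_hom: "p2 \<in> mon_hom P R"
proof (rule mon_homI)
  show "p2 t \<in> carrier R" if "t \<in> carrier P" for t using p2_closed that by blast
qed (auto simp: p2_def P_monoid_def DirProd_def R_monoid_def split: prod.splits)

text \<open>The semidirect product separates the pairs of \<open>R\<close> up to \<open>x \<mapsto> f x\<close>.\<close>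

definition semidirect :: "('k \<times> 'm) monoid" where
  "semidirect = \<lparr>carrier = carrier K \<times> carrier M,
    mult = (\<lambda>(a, m) (b, n). (a \<otimes>\<^bsub>K\<^esub> act m b, m \<otimes>\<^bsub>M\<^esub> n)), one = (\<one>\<^bsub>K\<^esub>, \<one>\<^bsub>M\<^esub>)\<rparr>"

definition sep :: "'x \<times> 'x \<Rightarrow> 'k \<times> 'm" where
  "sep = (\<lambda>(x, y). ((THE a. a \<in> carrier K \<and> y = k a \<otimes>\<^bsub>X\<^esub> x), f x))"

lemma sep_eq [simp]: "x \<in> carrier X \<Longrightarrow> a \<in> carrier K \<Longrightarrow> sep (x, k a \<otimes>\<^bsub>X\<^esub> x) = (a, f x)"
  using k_cancel by (auto simp: sep_def)

lemma sep_coequalises: "coequalises P R (pi1 K X k) p2 semidirect sep"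
  unfolding coequalises_def
proof (intro conjI ballI)
  show "monoid semidirect"
  proof (rule monoidI)
    show "x \<otimes>\<^bsub>semidirect\<^esub> y \<otimes>\<^bsub>semidirect\<^esub> z = x \<otimes>\<^bsub>semidirect\<^esub> (y \<otimes>\<^bsub>semidirect\<^esub> z)"
      if "x \<in> carrier semidirect" "y \<in> carrier semidirect" "z \<in> carrier semidirect" for x y z
      using that by (cases x; cases y; cases z)
        (simp add: semidirect_def act_add act_mult M.m_assoc K.m_assoc)
  qed (auto simp: semidirect_def act_one act_unit)
  show "sep \<in> mon_hom R semidirect"
  proof (rule mon_homI)
    show "sep p \<in> carrier semidirect" if "p \<in> carrier R" for p
      using that by (auto simp: carrier_R semidirect_def)
    show "sep (p \<otimes>\<^bsub>R\<^esub> q) = sep p \<otimes>\<^bsub>semidirect\<^esub> sep q"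
      if pR: "p \<in> carrier R" and qR: "q \<in> carrier R" for p q
    proof -
      obtain x a where xa: "x \<in> carrier X" "a \<in> carrier K" "p = (x, k a \<otimes>\<^bsub>X\<^esub> x)"
        using R_cases[OF pR] .
      obtain y b where yb: "y \<in> carrier X" "b \<in> carrier K" "q = (y, k b \<otimes>\<^bsub>X\<^esub> y)"
        using R_cases[OF qR] .
      note xy = xa(1) yb(1) xa(2) yb(2) and pq = xa(3) yb(3)
      have "sep (p \<otimes>\<^bsub>R\<^esub> q) = (a \<otimes>\<^bsub>K\<^esub> act (f x) b, f (x \<otimes>\<^bsub>X\<^esub> y))"
        unfolding pq mult_R R_mult[OF xy] by (rule sep_eq) (use xy in auto)
      then show ?thesis using xy pq by (simp add: semidirect_def)
    qed
    show "sep \<one>\<^bsub>R\<^esub> = \<one>\<^bsub>semidirect\<^esub>"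
      using sep_eq[of "\<one>\<^bsub>X\<^esub>" "\<one>\<^bsub>K\<^esub>"] by (simp add: semidirect_def)
  qed
  fix t assume "t \<in> carrier P"
  then obtain x a b where t: "t = (x, k a \<otimes>\<^bsub>X\<^esub> x, k b \<otimes>\<^bsub>X\<^esub> k a \<otimes>\<^bsub>X\<^esub> x)" "x \<in> carrier X" "a \<in> carrier K" "b \<in> carrier K"
    by (auto simp: carrier_P)
  show "sep (pi1 K X k t) = sep (p2 t)"
    unfolding t(1) pi1_eq[OF t(2-4)]
    using sep_eq[of "k a \<otimes>\<^bsub>X\<^esub> x" b] t(2-4) by (simp add: p2_def X.m_assoc)
qed

end

locale schreier_df = schreier K X M k f
  for K :: "('k, 'p) monoid_scheme" and X :: "('x, 'q) monoid_scheme" and M :: "('m, 'r) monoid_scheme"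
    and k f +
  fixes df :: "('d, 'l) monoid_scheme" and \<gamma> :: "'x \<times> 'x \<Rightarrow> 'd"
  assumes df: "is_df K X k df \<gamma>"
begin

lemma co: "coequaliser P R (pi1 K X k) p2 df \<gamma>" using df by (simp add: is_df_def)

sublocale df: monoid df
  using co by (simp add: coequaliser_def coequaliser_for_def coequalises_def)

lemma \<gamma>_hom: "\<gamma> \<in> mon_hom R df"
  and \<gamma>_coeq: "\<And>t. t \<in> carrier P \<Longrightarrow> \<gamma> (pi1 K X k t) = \<gamma> (p2 t)"
  using co by (simp_all add: coequaliser_def coequaliser_for_def coequalises_def)

lemma \<gamma>_surj: "\<gamma> ` carrier R = carrier df"
  by (rule coequaliser_surj[OF monoid_R pi1_closed p2_closed co])

lemma df_cases:
  assumes "d \<in> carrier df"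
  obtains x a where "x \<in> carrier X" "a \<in> carrier K" "d = \<gamma> (x, k a \<otimes>\<^bsub>X\<^esub> x)"
  using assms \<gamma>_surj unfolding carrier_R by blast

lemma \<gamma>_closed [simp]: "x \<in> carrier X \<Longrightarrow> a \<in> carrier K \<Longrightarrow> \<gamma> (x, k a \<otimes>\<^bsub>X\<^esub> x) \<in> carrier df"
  using \<gamma>_surj by auto

lemma \<gamma>_eq_iff:
  assumes "x \<in> carrier X" "y \<in> carrier X" "a \<in> carrier K" "b \<in> carrier K"
  shows "\<gamma> (x, k a \<otimes>\<^bsub>X\<^esub> x) = \<gamma> (y, k b \<otimes>\<^bsub>X\<^esub> y) \<longleftrightarrow> a = b \<and> f x = f y"
proof
  assume eq: "\<gamma> (x, k a \<otimes>\<^bsub>X\<^esub> x) = \<gamma> (y, k b \<otimes>\<^bsub>X\<^esub> y)"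
  obtain e where e: "\<And>p. p \<in> carrier R \<Longrightarrow> e (\<gamma> p) = sep p"
    using coequaliser_universal(2)[OF monoid_R pi1_closed p2_closed co sep_coequalises] by blast
  have "sep (x, k a \<otimes>\<^bsub>X\<^esub> x) = sep (y, k b \<otimes>\<^bsub>X\<^esub> y)"
    using e[of "(x, k a \<otimes>\<^bsub>X\<^esub> x)"] e[of "(y, k b \<otimes>\<^bsub>X\<^esub> y)"] eq assms by simp
  then show "a = b \<and> f x = f y" using assms by simp
next
  assume ab: "a = b \<and> f x = f y"
  have *: "\<gamma> (z, k b \<otimes>\<^bsub>X\<^esub> z) = \<gamma> (u, k b \<otimes>\<^bsub>X\<^esub> u)"
    if z: "z \<in> carrier X" "u \<in> rep (f z)" for z u
  proof -
    have u: "u \<in> carrier X" using z rep_closed by blast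
    obtain c where c: "c \<in> carrier K" "z = k c \<otimes>\<^bsub>X\<^esub> u" using rep_ex1 z by blast
    have "(u, k c \<otimes>\<^bsub>X\<^esub> u, k b \<otimes>\<^bsub>X\<^esub> k c \<otimes>\<^bsub>X\<^esub> u) \<in> carrier P" using c u assms by (auto simp: carrier_P)
    from \<gamma>_coeq[OF this] show ?thesis
      unfolding pi1_eq[OF u c(1) assms(4)] using c u assms by (simp add: p2_def X.m_assoc)
  qed
  obtain u where "u \<in> rep (f x)" using rep_ex[OF f_closed[OF assms(1)]] by blast
  then show "\<gamma> (x, k a \<otimes>\<^bsub>X\<^esub> x) = \<gamma> (y, k b \<otimes>\<^bsub>X\<^esub> y)"
    using *[OF assms(1), of u] *[OF assms(2), of u] ab by simp
qed

lemma \<gamma>_mult: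
  assumes "x \<in> carrier X" "y \<in> carrier X" "a \<in> carrier K" "b \<in> carrier K"
  shows "\<gamma> (x, k a \<otimes>\<^bsub>X\<^esub> x) \<otimes>\<^bsub>df\<^esub> \<gamma> (y, k b \<otimes>\<^bsub>X\<^esub> y)
    = \<gamma> (x \<otimes>\<^bsub>X\<^esub> y, k (a \<otimes>\<^bsub>K\<^esub> act (f x) b) \<otimes>\<^bsub>X\<^esub> (x \<otimes>\<^bsub>X\<^esub> y))"
  using mon_homD(2)[OF \<gamma>_hom, of "(x, k a \<otimes>\<^bsub>X\<^esub> x)" "(y, k b \<otimes>\<^bsub>X\<^esub> y)"] assms R_mult[OF assms]
  by simp

lemma fbar_eq: "x \<in> carrier X \<Longrightarrow> a \<in> carrier K \<Longrightarrow> fbar K X k f \<gamma> (\<gamma> (x, k a \<otimes>\<^bsub>X\<^esub> x)) = f x"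
  unfolding fbar_def by (rule the_equality) (auto simp: \<gamma>_eq_iff)

lemma qbar_eq: "x \<in> carrier X \<Longrightarrow> a \<in> carrier K \<Longrightarrow> qbar K X k \<gamma> (\<gamma> (x, k a \<otimes>\<^bsub>X\<^esub> x)) = a"
  unfolding qbar_def by (rule the_equality) (auto simp: \<gamma>_eq_iff)

lemma \<gamma>_diag: "x \<in> carrier X \<Longrightarrow> \<gamma> (x, x) = \<gamma> (x, k \<one>\<^bsub>K\<^esub> \<otimes>\<^bsub>X\<^esub> x)" by simp

lemma sbar_eq: "x \<in> carrier X \<Longrightarrow> sbar X f \<gamma> (f x) = \<gamma> (x, k \<one>\<^bsub>K\<^esub> \<otimes>\<^bsub>X\<^esub> x)"
  unfolding sbar_def
  by (rule the_equality) (use \<gamma>_eq_iff[of _ x "\<one>\<^bsub>K\<^esub>" "\<one>\<^bsub>K\<^esub>"] in auto)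

lemma kbar_eq: "a \<in> carrier K \<Longrightarrow> kbar X k \<gamma> a = \<gamma> (\<one>\<^bsub>X\<^esub>, k a \<otimes>\<^bsub>X\<^esub> \<one>\<^bsub>X\<^esub>)"
  by (simp add: kbar_def)

lemma one_df: "\<one>\<^bsub>df\<^esub> = \<gamma> (\<one>\<^bsub>X\<^esub>, k \<one>\<^bsub>K\<^esub> \<otimes>\<^bsub>X\<^esub> \<one>\<^bsub>X\<^esub>)"
  using mon_homD(3)[OF \<gamma>_hom] by simp

lemmas df_simps = \<gamma>_mult \<gamma>_eq_iff fbar_eq qbar_eq sbar_eq kbar_eq one_df

lemma retraction: "is_schreier_retraction K df (kbar X k \<gamma>) (fbar K X k f \<gamma>) (sbar X f \<gamma>) (qbar K X k \<gamma>)"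
  unfolding is_schreier_retraction_def
proof (intro conjI funcsetI ballI)
  fix d assume d: "d \<in> carrier df"
  obtain x a where x: "x \<in> carrier X" "a \<in> carrier K" and dx: "d = \<gamma> (x, k a \<otimes>\<^bsub>X\<^esub> x)"
    using df_cases[OF d] .
  show "qbar K X k \<gamma> d \<in> carrier K" using x by (simp add: dx qbar_eq)
  show "d = kbar X k \<gamma> (qbar K X k \<gamma> d) \<otimes>\<^bsub>df\<^esub> sbar X f \<gamma> (fbar K X k f \<gamma> d)"
    unfolding dx using x by (simp add: df_simps act_unit del: k_mult k_one X.r_one)
qed

lemma retraction_unique:
  assumes q: "is_schreier_retraction K df (kbar X k \<gamma>) (fbar K X k f \<gamma>) (sbar X f \<gamma>) q"
    and d: "d \<in> carrier df"
  shows "q d = qbar K X k \<gamma> d"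
proof -
  obtain x a where x: "x \<in> carrier X" "a \<in> carrier K" and dx: "d = \<gamma> (x, k a \<otimes>\<^bsub>X\<^esub> x)"
    using df_cases[OF d] .
  define b where "b = q d"
  have b: "b \<in> carrier K" and db: "d = kbar X k \<gamma> b \<otimes>\<^bsub>df\<^esub> sbar X f \<gamma> (fbar K X k f \<gamma> d)"
    using q d by (auto simp: is_schreier_retraction_def b_def)
  have fx: "fbar K X k f \<gamma> d = f x" using x by (simp add: dx fbar_eq)
  have "\<gamma> (x, k a \<otimes>\<^bsub>X\<^esub> x) = kbar X k \<gamma> b \<otimes>\<^bsub>df\<^esub> sbar X f \<gamma> (f x)"
    using db unfolding fx unfolding dx .
  then have "a = b" using x b by (simp add: df_simps act_unit del: k_mult k_one X.r_one)
  then show ?thesis using x dx b_def by (simp add: qbar_eq)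
qed

lemma point: "schreier_point K df M (kbar X k \<gamma>) (fbar K X k f \<gamma>) (sbar X f \<gamma>)"
proof -
  let ?f = "fbar K X k f \<gamma>" and ?s = "sbar X f \<gamma>" and ?k = "kbar X k \<gamma>"
  have f: "?f \<in> mon_hom df M"
  proof (rule mon_homI)
    show "?f d \<in> carrier M" if "d \<in> carrier df" for d
      using that by (rule df_cases) (simp add: fbar_eq)
    show "?f (d \<otimes>\<^bsub>df\<^esub> d') = ?f d \<otimes>\<^bsub>M\<^esub> ?f d'" if d: "d \<in> carrier df" "d' \<in> carrier df" for d d'
    proof -
      obtain x a where xa: "x \<in> carrier X" "a \<in> carrier K" "d = \<gamma> (x, k a \<otimes>\<^bsub>X\<^esub> x)" using df_cases[OF d(1)] .
      obtain y b where yb: "y \<in> carrier X" "b \<in> carrier K" "d' = \<gamma> (y, k b \<otimes>\<^bsub>X\<^esub> y)" using df_cases[OF d(2)] .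
      show ?thesis using xa yb by (simp add: df_simps del: k_mult)
    qed
    show "?f \<one>\<^bsub>df\<^esub> = \<one>\<^bsub>M\<^esub>" by (simp add: df_simps del: k_mult k_one X.r_one)
  qed
  have fs: "?f ` carrier df = carrier M"
  proof (intro equalityI subsetI)
    fix m assume "m \<in> carrier M"
    then obtain x where x: "x \<in> carrier X" "m = f x" using f_ex by blast
    then have "m = ?f (\<gamma> (x, k \<one>\<^bsub>K\<^esub> \<otimes>\<^bsub>X\<^esub> x))" by (simp only: fbar_eq K.one_closed)
    then show "m \<in> ?f ` carrier df" using x \<gamma>_closed K.one_closed by blast
  qed (use mon_homD(1)[OF f] in auto)
  have k: "is_kernel K df M ?k ?f"
    unfolding is_kernel_def iso_def bij_betw_def
  proof (intro CollectI conjI)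
    show "?k \<in> hom K (df\<lparr>carrier := kernel df M ?f\<rparr>)"
      by (auto simp: hom_def kernel_def df_simps act_one simp del: k_mult k_one X.r_one)
    show "inj_on ?k (carrier K)"
      by (auto simp: inj_on_def df_simps simp del: k_mult k_one X.r_one)
    show "?k ` carrier K = carrier (df\<lparr>carrier := kernel df M ?f\<rparr>)"
    proof (intro equalityI subsetI)
      fix d assume "d \<in> carrier (df\<lparr>carrier := kernel df M ?f\<rparr>)"
      then have d: "d \<in> carrier df" "?f d = \<one>\<^bsub>M\<^esub>" by (auto simp: kernel_def)
      obtain x a where x: "x \<in> carrier X" "a \<in> carrier K" "d = \<gamma> (x, k a \<otimes>\<^bsub>X\<^esub> x)"
        using df_cases[OF d(1)] .
      then have "d = ?k a" using d by (simp add: df_simps del: k_mult k_one X.r_one)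
      then show "d \<in> ?k ` carrier K" using x by blast
    qed (auto simp: kernel_def df_simps simp del: k_mult k_one X.r_one)
  qed
  have s: "?s \<in> mon_hom M df"
  proof (rule mon_homI)
    fix m assume "m \<in> carrier M"
    then obtain x where x: "x \<in> carrier X" "m = f x" using f_ex by blast
    then show "?s m \<in> carrier df" by (simp add: sbar_eq del: k_one)
  next
    fix m n assume m: "m \<in> carrier M" and n: "n \<in> carrier M"
    obtain x where x: "x \<in> carrier X" "m = f x" using f_ex[OF m] by blast
    obtain y where y: "y \<in> carrier X" "n = f y" using f_ex[OF n] by blast
    with x show "?s (m \<otimes>\<^bsub>M\<^esub> n) = ?s m \<otimes>\<^bsub>df\<^esub> ?s n"
      using sbar_eq[of "x \<otimes>\<^bsub>X\<^esub> y"] by (simp add: df_simps act_unit del: k_mult k_one X.r_one)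
  next
    show "?s \<one>\<^bsub>M\<^esub> = \<one>\<^bsub>df\<^esub>" using sbar_eq[of "\<one>\<^bsub>X\<^esub>"] one_df by simp
  qed
  have sf: "?f (?s m) = m" if m: "m \<in> carrier M" for m
  proof -
    obtain x where x: "x \<in> carrier X" "m = f x" using f_ex[OF m] by blast
    then show ?thesis by (simp add: sbar_eq fbar_eq del: k_one)
  qed
  have "\<exists>!q. q \<in> extensional (carrier df) \<and> is_schreier_retraction K df ?k ?f ?s q"
  proof (rule ex1I[of _ "restrict (qbar K X k \<gamma>) (carrier df)"])
    show "restrict (qbar K X k \<gamma>) (carrier df) \<in> extensional (carrier df) \<and>
        is_schreier_retraction K df ?k ?f ?s (restrict (qbar K X k \<gamma>) (carrier df))"
      using retraction by (auto simp: is_schreier_retraction_def)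
    show "q = restrict (qbar K X k \<gamma>) (carrier df)"
      if "q \<in> extensional (carrier df) \<and> is_schreier_retraction K df ?k ?f ?s q" for q
      using that retraction_unique by (intro extensionalityI[of _ "carrier df"]) auto
  qed
  then show ?thesis
    using f fs k s sf K.monoid_axioms M.monoid_axioms df.monoid_axioms
    by (simp add: schreier_point_def split_extension_def monoid_extension_def)
qed

end

lemma associated_schreier_point:
  assumes "schreier_extension K X M k f" and "comm_monoid_cancel K" and "is_df K X k df \<gamma>"
  shows "schreier_point K df M (kbar X k \<gamma>) (fbar K X k f \<gamma>) (sbar X f \<gamma>)"
    and "is_schreier_retraction K df (kbar X k \<gamma>) (fbar K X k f \<gamma>) (sbar X f \<gamma>) (qbar K X k \<gamma>)"
    and "x \<in> carrier X \<Longrightarrow> a \<in> carrier K \<Longrightarrow> fbar K X k f \<gamma> (\<gamma> (x, k a \<otimes>\<^bsub>X\<^esub> x)) = f x"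
    and "x \<in> carrier X \<Longrightarrow> a \<in> carrier K \<Longrightarrow> qbar K X k \<gamma> (\<gamma> (x, k a \<otimes>\<^bsub>X\<^esub> x)) = a"
    and "x \<in> carrier X \<Longrightarrow> sbar X f \<gamma> (f x) = \<gamma> (x, x)"
proof -
  interpret schreier_df K X M k f df \<gamma>
    by (intro schreier_df.intro schreier.intro schreier_df_axioms.intro) (rule assms)+
  show "schreier_point K df M (kbar X k \<gamma>) (fbar K X k f \<gamma>) (sbar X f \<gamma>)" by (rule point)
  show "is_schreier_retraction K df (kbar X k \<gamma>) (fbar K X k f \<gamma>) (sbar X f \<gamma>) (qbar K X k \<gamma>)"
    by (rule retraction)
  show "x \<in> carrier X \<Longrightarrow> a \<in> carrier K \<Longrightarrow> fbar K X k f \<gamma> (\<gamma> (x, k a \<otimes>\<^bsub>X\<^esub> x)) = f x" by (rule fbar_eq)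
  show "x \<in> carrier X \<Longrightarrow> a \<in> carrier K \<Longrightarrow> qbar K X k \<gamma> (\<gamma> (x, k a \<otimes>\<^bsub>X\<^esub> x)) = a" by (rule qbar_eq)
  show "x \<in> carrier X \<Longrightarrow> sbar X f \<gamma> (f x) = \<gamma> (x, x)" by (simp add: sbar_eq)
qed

end

theory Submission
  imports Defs
begin

text \<open>For \<open>m = f x\<close>, the product is \<open>\<gamma> (x, x) \<otimes> \<gamma>
  (\<one>, k a) = \<gamma> (x, x \<otimes> k a)\<close>. By \<open>act_eq\<close>,
  \<open>x \<otimes> k a = k (act m a) \<otimes> x\<close> for every \<open>x\<close> over
  \<open>m\<close>, not only for representatives, so \<open>qbar\<close> reads off
  \<open>act m a\<close>.\<close>

theorem proposition6p10:
  fixes K :: "'k monoid" and X :: "'x monoid" and M :: "'m monoid"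
    and k :: "'k \<Rightarrow> 'x" and f :: "'x \<Rightarrow> 'm"
    and df :: "'d monoid" and \<gamma> :: "'x \<times> 'x \<Rightarrow> 'd"
  assumes "schreier_extension K X M k f"
    and "comm_monoid_cancel K"
    and "is_df K X k df \<gamma>"
  shows "\<forall>m\<in>carrier M. \<forall>a\<in>carrier K.
           qbar K X k \<gamma> (sbar X f \<gamma> m \<otimes>\<^bsub>df\<^esub> kbar X k \<gamma> a) = extension_action K X k f m a"
proof (intro ballI)
  interpret schreier_df K X M k f df \<gamma>
    by (intro schreier_df.intro schreier.intro schreier_df_axioms.intro) (rule assms)+
  fix m a assume m: "m \<in> carrier M" and a: "a \<in> carrier K"
  obtain x where x: "x \<in> carrier X" "m = f x" using f_ex[OF m] by blast
  show "qbar K X k \<gamma> (sbar X f \<gamma> m \<otimes>\<^bsub>df\<^esub> kbar X k \<gamma> a) = extension_action K X k f m a"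
    \<comment> \<open>Units stay unsimplified to keep all pairs in the form
      \<open>(y, k b \<otimes> y)\<close>, on which \<open>\<gamma>_mult\<close> and
      \<open>qbar_eq\<close> match.\<close>
    using x a by (simp add: df_simps del: k_mult k_one X.r_one)
qed

end
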